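(* Let $G$ be a finite graph with at least one vertex. Then the limit $$F(G)=\lim_{k\to\infty}\frac{\log \alpha(G[k])}{\log k}$$ exists and $F(G)=\alpha(G)-1$.
   Context: Graphs are finite, simple and undirected; $\alpha(\cdot)$ denotes the independence number (the maximum size of a set of pairwise non-adjacent vertices). For a finite graph $G$ with vertex set $V$ and $k\in\mathbb{N}$, the graph $G[k]$ is defined as follows. Its vertices are the configurations of $k$ identical pebbles on the vertices of $G$, i.e. the functions $f:V\to\mathbb{Z}_{\geq 0}$ with $\sum_{v\in V} f(v)=k$. Two distinct configurations $f$ and $g$ are adjacent in $G[k]$ if $g$ can be obtained from $f$ by (simultaneously) moving some of the pebbles, each moved pebble going to a neighbour in $G$ of the vertex it lies on; that is, if there are maps $\varphi,\gamma:\{1,\dots,k\}\to V$ with $|\varphi^{-1}(v)|=f(v)$ and $|\gamma^{-1}(v)|=g(v)$ for all $v\in V$, such that for every $i$ either $\varphi(i)=\gamma(i)$ or $\varphi(i)$ and $\gamma(i)$ are adjacent in $G$. (Equivalently, $G[k]$ is the quotient of the $k$-fold strong power $G^{\boxtimes k}$ by the action of the symmetric group $S_k$ permuting coordinates.) *)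

theory Defs
  imports Complex_Main "HOL-Library.FuncSet" "Graph_Theory.Pair_Digraph"
begin

text \<open>
  A finite simple undirected graph is a \<^locale>\<open>pair_graph\<close>: its arc set is a finite,
  symmetric, loop-free set of pairs of vertices, an edge being the two opposite arcs.
\<close>

definition independent_set :: "'a pair_pre_digraph \<Rightarrow> 'a set \<Rightarrow> bool" where
  "independent_set G S \<longleftrightarrow>
     S \<subseteq> pverts G \<and> pairwise (\<lambda>u v. (u, v) \<notin> parcs G) S"

definition independence_number :: "'a pair_pre_digraph \<Rightarrow> nat" where
  "independence_number G = Max (card ` {S. independent_set G S})"

text \<open>
  Configurations are total functions on the vertex type; requiring them to vanish off the
  vertex set gives each function on the vertex set exactly one representative.
\<close>

definition configurations :: "'a set \<Rightarrow> nat \<Rightarrow> ('a \<Rightarrow> nat) set" where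
  "configurations V k = {f. (\<forall>v. v \<notin> V \<longrightarrow> f v = 0) \<and> (\<Sum>v\<in>V. f v) = k}"

definition pebble_move ::
    "'a pair_pre_digraph \<Rightarrow> nat \<Rightarrow> ('a \<Rightarrow> nat) \<Rightarrow> ('a \<Rightarrow> nat) \<Rightarrow> bool" where
  "pebble_move G k f g \<longleftrightarrow>
     (\<exists>\<phi> \<gamma>. \<phi> \<in> {1..k} \<rightarrow> pverts G \<and> \<gamma> \<in> {1..k} \<rightarrow> pverts G \<and>
        (\<forall>v\<in>pverts G. card {i\<in>{1..k}. \<phi> i = v} = f v) \<and>
        (\<forall>v\<in>pverts G. card {i\<in>{1..k}. \<gamma> i = v} = g v) \<and>
        (\<forall>i\<in>{1..k}. \<phi> i = \<gamma> i \<or> (\<phi> i, \<gamma> i) \<in> parcs G))"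

definition pebble_graph :: "'a pair_pre_digraph \<Rightarrow> nat \<Rightarrow> ('a \<Rightarrow> nat) pair_pre_digraph" where
  "pebble_graph G k =
     \<lparr> pverts = configurations (pverts G) k,
       parcs = {(f, g). f \<in> configurations (pverts G) k \<and> g \<in> configurations (pverts G) k \<and>
                        f \<noteq> g \<and> pebble_move G k f g} \<rparr>"

lemma finite_configurations:
  assumes "finite V"
  shows "finite (configurations V k)"
proof (rule finite_subset)
  show "configurations V k \<subseteq>
      {f. \<forall>v. (v \<in> V \<longrightarrow> f v \<in> {..k}) \<and> (v \<notin> V \<longrightarrow> f v = 0)}"
    using member_le_sum[OF _ _ assms, where ?'b = nat]
    by (auto simp: configurations_def)
  show "finite {f :: 'a \<Rightarrow> nat. \<forall>v. (v \<in> V \<longrightarrow> f v \<in> {..k}) \<and> (v \<notin> V \<longrightarrow> f v = 0)}"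
    by (rule finite_set_of_finite_funs[OF assms]) simp
qed

lemma pebble_move_sym:
  assumes "pair_graph G" "pebble_move G k f g"
  shows "pebble_move G k g f"
proof -
  interpret pair_graph G by fact
  have s: "(v, u) \<in> parcs G" if "(u, v) \<in> parcs G" for u v
    using that arcs_symmetric by simp
  from assms(2) obtain \<phi> \<gamma> where
    "\<phi> \<in> {1..k} \<rightarrow> pverts G" "\<gamma> \<in> {1..k} \<rightarrow> pverts G"
    "\<forall>v\<in>pverts G. card {i\<in>{1..k}. \<phi> i = v} = f v"
    "\<forall>v\<in>pverts G. card {i\<in>{1..k}. \<gamma> i = v} = g v"
    and m: "\<forall>i\<in>{1..k}. \<phi> i = \<gamma> i \<or> (\<phi> i, \<gamma> i) \<in> parcs G"
    unfolding pebble_move_def by blast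
  moreover have "\<forall>i\<in>{1..k}. \<gamma> i = \<phi> i \<or> (\<gamma> i, \<phi> i) \<in> parcs G"
    using m s by fastforce
  ultimately show ?thesis
    unfolding pebble_move_def by (intro exI[of _ \<gamma>] exI[of _ \<phi>] conjI)
qed

lemma pair_graph_pebble_graph:
  assumes "pair_graph G"
  shows "pair_graph (pebble_graph G k)"
proof -
  interpret pair_graph G by fact
  have fin: "finite (configurations (pverts G) k)"
    by (rule finite_configurations) simp
  show ?thesis
  proof
    show "finite (parcs (pebble_graph G k))"
      by (rule finite_subset[OF _ finite_cartesian_product[OF fin fin]])
        (auto simp: pebble_graph_def)
    show "symmetric (with_proj (pebble_graph G k))"
      unfolding symmetric_def
      by (rule symI) (auto simp: pebble_graph_def intro: pebble_move_sym[OF assms])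
  qed (use fin in \<open>auto simp: pebble_graph_def\<close>)
qed

end

(* Lower bound: configurations supported on an independent set of G are pairwise non-adjacent.

   Upper bound: listing the vertices by decreasing number of pebbles, a greedy choice gives an
   independent set of centres and assigns to every vertex an equal or adjacent centre that carries
   at least as many pebbles.  If two configurations have the same stars, the same number of pebbles
   on every star, and almost equal values at every vertex (up to a factor 1 + 1/n, where n is the
   number of vertices), each star can rebalance through its centre in one step, so they are equal
   or adjacent.  There are constantly many star partitions, polylogarithmically many patterns of
   magnitudes, and at most (k + 1) ^ (alpha(G) - 1) distributions of k pebbles over the stars. *)

theory Submission
  imports Defs "HOL-Real_Asymp.Real_Asymp"
begin

section \<open>Independence numbers of finite graphs\<close>

lemma finite_independent_sets:
  assumes "finite (pverts G)"
  shows "finite {S. independent_set G S}"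
  by (rule finite_subset[of _ "Pow (pverts G)"]) (auto simp: independent_set_def assms)

lemma card_le_independence_number:
  assumes "finite (pverts G)" "independent_set G S"
  shows "card S \<le> independence_number G"
  unfolding independence_number_def
  using assms finite_independent_sets by (intro Max_ge) auto

lemma independence_number_attained:
  assumes "finite (pverts G)"
  obtains S where "independent_set G S" "card S = independence_number G"
proof -
  have "independent_set G {}"
    by (simp add: independent_set_def)
  then have "independence_number G \<in> card ` {S. independent_set G S}"
    unfolding independence_number_def
    using finite_independent_sets[OF assms] by (intro Max_in) auto
  then show thesis
    using that by auto
qed

section \<open>Building and restricting pebble moves\<close>

text \<open>Moves are easier to build as transport matrices, with \<open>m v w\<close> pebbles going
  from \<open>v\<close> to \<open>w\<close>, than by naming individual pebbles. Numbering the
  transported pebbles from 1 to \<open>k\<close> turns their sources and targets into the two maps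
  that the definition asks for.\<close>

lemma pebble_moveI:
  fixes m :: "'a \<Rightarrow> 'a \<Rightarrow> nat"
  assumes fin: "finite (pverts G)"
    and k: "(\<Sum>v\<in>pverts G. f v) = k"
    and out: "\<And>v. v \<in> pverts G \<Longrightarrow> (\<Sum>w\<in>pverts G. m v w) = f v"
    and inn: "\<And>w. w \<in> pverts G \<Longrightarrow> (\<Sum>v\<in>pverts G. m v w) = g w"
    and arc: "\<And>v w. \<lbrakk>v \<in> pverts G; w \<in> pverts G; m v w \<noteq> 0\<rbrakk> \<Longrightarrow> v = w \<or> (v, w) \<in> parcs G"
  shows "pebble_move G k f g"
proof -
  let ?V = "pverts G"
  \<comment> \<open>An element \<open>((v, w), j)\<close> of \<open>P\<close> stands for one of the
    \<open>m v w\<close> pebbles travelling from \<open>v\<close> to \<open>w\<close>.\<close>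
  define P where "P = (SIGMA p:?V \<times> ?V. {..<m (fst p) (snd p)})"
  have "card P = (\<Sum>p\<in>?V \<times> ?V. m (fst p) (snd p))"
    using fin by (simp add: P_def card_SigmaI)
  also have "\<dots> = (\<Sum>v\<in>?V. \<Sum>w\<in>?V. m v w)"
    by (simp add: sum.cartesian_product case_prod_unfold)
  also have "\<dots> = k"
    using k out by simp
  finally have "card P = card {1..k}"
    by simp
  moreover have "finite P"
    using fin by (auto simp: P_def)
  ultimately obtain h where h: "bij_betw h {1..k} P"
    using finite_same_card_bij by (metis finite_atLeastAtMost)
  have hP: "fst (fst (h i)) \<in> ?V" "snd (fst (h i)) \<in> ?V" "m (fst (fst (h i))) (snd (fst (h i))) \<noteq> 0"
    if "i \<in> {1..k}" for i
  proof -
    have "h i \<in> P"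
      using h that by (rule bij_betwE[rule_format])
    then show "fst (fst (h i)) \<in> ?V" "snd (fst (h i)) \<in> ?V" "m (fst (fst (h i))) (snd (fst (h i))) \<noteq> 0"
      by (auto simp: P_def)
  qed
  have fibre: "card {i\<in>{1..k}. Q (h i)} = card {p\<in>P. Q p}" for Q
  proof -
    have P: "P = h ` {1..k}"
      using h by (simp add: bij_betw_def)
    have inj: "inj_on h {i\<in>{1..k}. Q (h i)}"
      by (rule inj_on_subset[OF bij_betw_imp_inj_on[OF h]]) blast
    have "h ` {i\<in>{1..k}. Q (h i)} = {p\<in>P. Q p}"
      unfolding P by blast
    with card_image[OF inj] show ?thesis
      by simp
  qed
  show ?thesis
    unfolding pebble_move_def
  proof (intro exI conjI ballI)
    show "(\<lambda>i. fst (fst (h i))) \<in> {1..k} \<rightarrow> ?V" "(\<lambda>i. snd (fst (h i))) \<in> {1..k} \<rightarrow> ?V"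
      using hP by blast+
    fix v assume v: "v \<in> ?V"
    have "{p\<in>P. fst (fst p) = v} = (SIGMA p:{v} \<times> ?V. {..<m (fst p) (snd p)})"
      using v by (auto simp: P_def)
    then have "card {p\<in>P. fst (fst p) = v} = (\<Sum>p\<in>{v} \<times> ?V. m (fst p) (snd p))"
      using fin by (simp add: card_SigmaI)
    also have "\<dots> = f v"
      using out[OF v] sum.cartesian_product[of m ?V "{v}"] by (simp add: case_prod_unfold)
    finally show "card {i\<in>{1..k}. fst (fst (h i)) = v} = f v"
      using fibre[of "\<lambda>p. fst (fst p) = v"] by simp
    have "{p\<in>P. snd (fst p) = v} = (SIGMA p:?V \<times> {v}. {..<m (fst p) (snd p)})"
      using v by (auto simp: P_def)
    then have "card {p\<in>P. snd (fst p) = v} = (\<Sum>p\<in>?V \<times> {v}. m (fst p) (snd p))"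
      using fin by (simp add: card_SigmaI)
    also have "\<dots> = g v"
      using inn[OF v] sum.cartesian_product[of m "{v}" ?V] by (simp add: case_prod_unfold)
    finally show "card {i\<in>{1..k}. snd (fst (h i)) = v} = g v"
      using fibre[of "\<lambda>p. snd (fst p) = v"] by simp
  next
    fix i assume "i \<in> {1..k}"
    then show "fst (fst (h i)) = snd (fst (h i)) \<or> (fst (fst (h i)), snd (fst (h i))) \<in> parcs G"
      by (intro arc hP)
  qed
qed

text \<open>Every pebble starts and ends on an occupied vertex, hence in \<open>S\<close>. Since
  \<open>S\<close> contains no edge, no pebble can have moved.\<close>

lemma pebble_move_independent_eq:
  assumes S: "independent_set G S"
    and f: "\<And>v. v \<notin> S \<Longrightarrow> f v = 0" and g: "\<And>v. v \<notin> S \<Longrightarrow> g v = 0"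
    and move: "pebble_move G k f g"
  shows "f = g"
proof -
  let ?V = "pverts G"
  from move obtain \<phi> \<gamma> where V: "\<phi> \<in> {1..k} \<rightarrow> ?V" "\<gamma> \<in> {1..k} \<rightarrow> ?V"
    and cf: "\<forall>v\<in>?V. card {i\<in>{1..k}. \<phi> i = v} = f v"
    and cg: "\<forall>v\<in>?V. card {i\<in>{1..k}. \<gamma> i = v} = g v"
    and step: "\<forall>i\<in>{1..k}. \<phi> i = \<gamma> i \<or> (\<phi> i, \<gamma> i) \<in> parcs G"
    unfolding pebble_move_def by blast
  have eq: "\<phi> i = \<gamma> i" if i: "i \<in> {1..k}" for i
  proof -
    have "card {j\<in>{1..k}. \<phi> j = \<phi> i} = f (\<phi> i)" "card {j\<in>{1..k}. \<gamma> j = \<gamma> i} = g (\<gamma> i)"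
      using cf cg V[THEN funcset_mem, OF i] by simp_all
    \<comment> \<open>Pebble \<open>i\<close> itself belongs to both fibres, so neither is
      empty.\<close>
    moreover have "card {j\<in>{1..k}. \<phi> j = \<phi> i} \<noteq> 0" "card {j\<in>{1..k}. \<gamma> j = \<gamma> i} \<noteq> 0"
      using i by auto
    ultimately have "f (\<phi> i) \<noteq> 0" "g (\<gamma> i) \<noteq> 0"
      by simp_all
    then have "\<phi> i \<in> S" "\<gamma> i \<in> S"
      using f g by metis+
    then have "(\<phi> i, \<gamma> i) \<notin> parcs G" if "\<phi> i \<noteq> \<gamma> i"
      using S that by (simp add: independent_set_def pairwise_def)
    then show ?thesis
      using step i by blast
  qed
  have "f v = g v" for v
  proof (cases "v \<in> ?V")
    case True
    have "{i\<in>{1..k}. \<phi> i = v} = {i\<in>{1..k}. \<gamma> i = v}"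
      using eq by auto
    then show ?thesis
      using cf cg True by metis
  next
    case False
    then show ?thesis
      using f g S by (metis independent_set_def subsetD)
  qed
  then show ?thesis ..
qed

section \<open>Counting configurations\<close>

text \<open>All vertices except one may receive any number up to \<open>k div card S\<close>
  independently, without exceeding \<open>k\<close> in total; the last vertex takes the
  remainder.\<close>

lemma card_configurations_ge:
  assumes "finite S" "S \<noteq> {}"
  shows "(k div card S + 1) ^ (card S - 1) \<le> card (configurations S k)"
proof -
  obtain s where s: "s \<in> S"
    using assms by auto
  define T where "T = S - {s}"
  have T: "finite T" "s \<notin> T" "S = insert s T" "card T = card S - 1"
    using assms s by (auto simp: T_def)
  let ?A = "T \<rightarrow>\<^sub>E {..k div card S}"
  \<comment> \<open>The subtraction never truncates, because \<open>sum h T\<close> turns out to be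
    at most \<open>k\<close>.\<close>
  define F where "F h = (\<lambda>v. if v = s then k - sum h T else if v \<in> T then h v else 0)" for h
  have "inj_on F ?A"
  proof (rule inj_onI)
    fix h h' assume h: "h \<in> ?A" "h' \<in> ?A" and e: "F h = F h'"
    show "h = h'"
    proof (rule PiE_ext[OF h])
      fix v assume "v \<in> T"
      then show "h v = h' v"
        using fun_cong[OF e, of v] T by (auto simp: F_def split: if_splits)
    qed
  qed
  moreover have "F ` ?A \<subseteq> configurations S k"
  proof
    fix x assume "x \<in> F ` ?A"
    then obtain h where h: "h \<in> ?A" and x: "x = F h"
      by auto
    have "sum h T \<le> (\<Sum>v\<in>T. k div card S)"
      using h by (intro sum_mono) auto
    also have "\<dots> \<le> card S * (k div card S)"
      using T by simp
    also have "\<dots> \<le> k"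
      by simp
    finally have "sum h T \<le> k" .
    moreover have "sum (F h) T = sum h T"
      using T by (intro sum.cong) (auto simp: F_def)
    ultimately show "x \<in> configurations S k"
      using T by (auto simp: configurations_def x F_def)
  qed
  ultimately have "card ?A \<le> card (configurations S k)"
    using finite_configurations[OF assms(1)] by (intro card_inj_on_le)
  then show ?thesis
    by (simp add: card_PiE T(1,4))
qed

text \<open>As the total is fixed, a configuration is determined by its values away from one vertex,
  each at most \<open>k\<close>.\<close>

lemma card_configurations_le:
  assumes "finite S" "S \<noteq> {}"
  shows "card (configurations S k) \<le> (k + 1) ^ (card S - 1)"
proof -
  obtain s where s: "s \<in> S"
    using assms by auto
  define T where "T = S - {s}"
  have T: "finite T" "s \<notin> T" "S = insert s T" "card T = card S - 1"
    using assms s by (auto simp: T_def)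
  let ?A = "T \<rightarrow>\<^sub>E {..k}"
  have "inj_on (\<lambda>f. restrict f T) (configurations S k)"
  proof (rule inj_onI)
    fix f g assume f: "f \<in> configurations S k" and g: "g \<in> configurations S k"
      and e: "restrict f T = restrict g T"
    have eT: "f v = g v" if "v \<in> T" for v
      using fun_cong[OF e, of v] that by simp
    then have "sum f T = sum g T"
      by (rule sum.cong[OF refl])
    then have "f s = g s"
      using f g T(1-3) by (auto simp: configurations_def)
    moreover have "f v = 0" "g v = 0" if "v \<notin> S" for v
      using f g that by (simp_all add: configurations_def)
    ultimately show "f = g"
      using eT T(3) by (metis ext insertE)
  qed
  moreover have "(\<lambda>f. restrict f T) ` configurations S k \<subseteq> ?A"
  proof
    fix x assume "x \<in> (\<lambda>f. restrict f T) ` configurations S k"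
    then obtain f where f: "f \<in> configurations S k" "x = restrict f T"
      by auto
    have "f v \<le> k" if "v \<in> T" for v
      using member_le_sum[of v S f] f T(1-3) that by (auto simp: configurations_def)
    then show "x \<in> ?A"
      using f by auto
  qed
  ultimately have "card (configurations S k) \<le> card ?A"
    using T(1) by (intro card_inj_on_le) (auto intro!: finite_PiE)
  then show ?thesis
    by (simp add: card_PiE T(1,4))
qed

section \<open>The lower bound\<close>

lemma independence_number_pebble_graph_ge:
  assumes "pair_graph G" "pverts G \<noteq> {}"
  shows "(k div independence_number G + 1) ^ (independence_number G - 1)
    \<le> independence_number (pebble_graph G k)"
proof -
  interpret pair_graph G by fact
  have fin: "finite (pverts G)" "finite (pverts (pebble_graph G k))"
    by (simp_all add: pebble_graph_def finite_configurations)
  obtain S where S: "independent_set G S" "card S = independence_number G"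
    using independence_number_attained[OF fin(1)] .
  obtain v where v: "v \<in> pverts G"
    using assms(2) by auto
  \<comment> \<open>A positive cardinality makes \<open>S\<close> nonempty and also finite, since
    infinite sets have \<open>card\<close> 0.\<close>
  have "card {v} \<le> independence_number G"
    using v by (intro card_le_independence_number) (auto simp: independent_set_def)
  then have S_ne: "S \<noteq> {}" "finite S"
    using S card.infinite by fastforce+
  have SV: "S \<subseteq> pverts G"
    using S by (simp add: independent_set_def)
  have "independent_set (pebble_graph G k) (configurations S k)"
    unfolding independent_set_def
  proof
    show "configurations S k \<subseteq> pverts (pebble_graph G k)"
    proof
      fix f assume f: "f \<in> configurations S k"
      have "sum f (pverts G) = sum f S"
        using f SV by (intro sum.mono_neutral_right) (auto simp: configurations_def)
      then show "f \<in> pverts (pebble_graph G k)"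
        using f SV by (auto simp: configurations_def pebble_graph_def)
    qed
    show "pairwise (\<lambda>f g. (f, g) \<notin> parcs (pebble_graph G k)) (configurations S k)"
    proof (rule pairwiseI)
      fix f g assume "f \<in> configurations S k" "g \<in> configurations S k" "f \<noteq> g"
      then have "\<not> pebble_move G k f g"
        using pebble_move_independent_eq[OF S(1), of f g k] by (auto simp: configurations_def)
      then show "(f, g) \<notin> parcs (pebble_graph G k)"
        by (simp add: pebble_graph_def)
    qed
  qed
  then have "card (configurations S k) \<le> independence_number (pebble_graph G k)"
    by (intro card_le_independence_number fin)
  then show ?thesis
    using card_configurations_ge[OF S_ne(2,1), of k] unfolding S(2) by simp
qed

section \<open>Star partitions and rebalancing\<close>

text \<open>Vertices are processed by decreasing \<open>f\<close>. A new vertex adjacent to an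
  earlier centre is dominated by it, as that centre carries at least as many pebbles; otherwise it
  becomes a centre itself.\<close>

lemma ex_dominating_independent_set:
  fixes f :: "'a \<Rightarrow> nat"
  assumes "pair_graph G" "finite U" "U \<subseteq> pverts G"
  shows "\<exists>S\<subseteq>U. independent_set G S \<and>
    (\<forall>v\<in>U. \<exists>s\<in>S. (v = s \<or> (v, s) \<in> parcs G) \<and> f v \<le> f s)"
proof -
  interpret pair_graph G by fact
  have sym: "(v, u) \<in> parcs G" if "(u, v) \<in> parcs G" for u v
    using that arcs_symmetric by simp
  from assms(2,3) show ?thesis
  \<comment> \<open>Negating \<open>f\<close> makes each inserted vertex one with the fewest pebbles
    so far.\<close>
  proof (induction U rule: finite_ranking_induct[where f = "\<lambda>v. - int (f v)"])
    case empty
    then show ?case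
      by (simp add: independent_set_def)
  next
    case (insert x U)
    then obtain S where S: "S \<subseteq> U" "independent_set G S"
      and dom: "\<forall>v\<in>U. \<exists>s\<in>S. (v = s \<or> (v, s) \<in> parcs G) \<and> f v \<le> f s"
      by auto
    show ?case
    proof (cases "\<exists>s\<in>S. (x, s) \<in> parcs G")
      case True
      then obtain s where "s \<in> S" "(x, s) \<in> parcs G"
        by auto
      moreover from this have "f x \<le> f s"
        using insert.hyps(2) S by fastforce
      ultimately show ?thesis
        using S dom by (intro exI[of _ S]) auto
    next
      case False
      then have "independent_set G (insert x S)"
        using S insert.prems sym by (auto simp: independent_set_def pairwise_insert)
      then show ?thesis
        using S dom by (intro exI[of _ "insert x S"]) auto
    qed
  qed
qed

text \<open>The fibres of \<open>\<sigma>\<close> are the stars and its image is the set of centres.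
  Taking \<open>\<sigma>\<close> extensional leaves at most n^n such maps on n vertices.\<close>

definition star_partition :: "'a pair_pre_digraph \<Rightarrow> ('a \<Rightarrow> nat) \<Rightarrow> ('a \<Rightarrow> 'a) \<Rightarrow> bool" where
  "star_partition G f \<sigma> \<longleftrightarrow>
     \<sigma> \<in> pverts G \<rightarrow>\<^sub>E pverts G \<and> independent_set G (\<sigma> ` pverts G) \<and>
     (\<forall>v\<in>pverts G. \<sigma> (\<sigma> v) = \<sigma> v \<and> (v = \<sigma> v \<or> (v, \<sigma> v) \<in> parcs G) \<and> f v \<le> f (\<sigma> v))"

lemma ex_star_partition:
  assumes "pair_graph G"
  shows "\<exists>\<sigma>. star_partition G f \<sigma>"
proof -
  interpret pair_graph G by fact
  obtain S where S: "S \<subseteq> pverts G" "independent_set G S"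
    and dom: "\<forall>v\<in>pverts G. \<exists>s\<in>S. (v = s \<or> (v, s) \<in> parcs G) \<and> f v \<le> f s"
    using ex_dominating_independent_set[OF assms, of "pverts G" f] by auto
  then obtain t where
    t: "\<forall>v\<in>pverts G. t v \<in> S \<and> (v = t v \<or> (v, t v) \<in> parcs G) \<and> f v \<le> f (t v)"
    by metis
  \<comment> \<open>Fixing the members of \<open>S\<close> outright gives idempotence and image
    \<open>S\<close> at once.\<close>
  define \<sigma> where "\<sigma> = (\<lambda>v\<in>pverts G. if v \<in> S then v else t v)"
  have "\<sigma> ` pverts G = S"
    using S t by (auto simp: \<sigma>_def image_iff)
  moreover have "\<sigma> \<in> pverts G \<rightarrow>\<^sub>E pverts G"
    using S t by (auto simp: \<sigma>_def)
  ultimately show ?thesis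
    using S t by (intro exI[of _ \<sigma>]) (auto simp: star_partition_def \<sigma>_def)
qed

text \<open>All exchange inside a star passes through its centre. The only danger is that the centre
  lacks pebbles for its gaining leaves; closeness and the fact that no leaf carries more than its
  centre exclude this. Equal star totals then give the centre the right final number.\<close>

lemma pebble_move_along_stars:
  assumes "pair_graph G" "star_partition G f \<sigma>"
    and k: "(\<Sum>v\<in>pverts G. f v) = k"
    and close: "\<And>v. v \<in> pverts G \<Longrightarrow> card (pverts G) * (g v - f v) \<le> f v"
    and total: "\<And>s. s \<in> pverts G \<Longrightarrow>
      (\<Sum>v\<in>{v\<in>pverts G. \<sigma> v = s}. f v) = (\<Sum>v\<in>{v\<in>pverts G. \<sigma> v = s}. g v)"
  shows "pebble_move G k f g"
proof -
  interpret pair_graph G by fact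
  let ?V = "pverts G"
  have sym: "(v, u) \<in> parcs G" if "(u, v) \<in> parcs G" for u v
    using that arcs_symmetric by simp
  have \<sigma>: "\<sigma> v \<in> ?V" "\<sigma> (\<sigma> v) = \<sigma> v" "v = \<sigma> v \<or> (v, \<sigma> v) \<in> parcs G" "f v \<le> f (\<sigma> v)"
    if "v \<in> ?V" for v
    using assms(2) that by (auto simp: star_partition_def)
  define L where "L s = {v\<in>?V. \<sigma> v = s \<and> v \<noteq> s}" for s
  have finL: "finite (L s)" for s
    by (auto simp: L_def)
  \<comment> \<open>\<open>D s\<close> is the total deficit of the leaves of \<open>s\<close>:
    truncated subtraction ignores the leaves that lose pebbles.\<close>
  define D where "D s = (\<Sum>w\<in>L s. g w - f w)" for s
  have D_le: "D s \<le> f s" if s: "s \<in> ?V" for s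
  proof -
    \<comment> \<open>Each leaf gains at most a fraction 1 / \<open>card ?V\<close> of the pebbles
      on the centre, and there are at most \<open>card ?V\<close> leaves.\<close>
    have "card ?V * D s \<le> (\<Sum>w\<in>L s. f w)"
      unfolding D_def sum_distrib_left by (intro sum_mono close) (auto simp: L_def)
    also have "\<dots> \<le> (\<Sum>w\<in>L s. f s)"
      using \<sigma>(4) by (intro sum_mono) (auto simp: L_def)
    also have "\<dots> \<le> card ?V * f s"
      by (auto simp: L_def intro!: mult_right_mono card_mono)
    finally show ?thesis
      using s by (auto simp: card_gt_0_iff)
  qed
  \<comment> \<open>Every leaf keeps what it can; its surplus goes to its centre, its deficit comes from there.\<close>
  define m where "m v w =
    (if v = w then (if \<sigma> v = v then f v - D v else min (f v) (g v))
     else if \<sigma> v = w then f v - g v else if \<sigma> w = v then g w - f w else 0)" for v w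
  show ?thesis
  proof (rule pebble_moveI[where m = m])
    show "finite ?V" by simp
    show "(\<Sum>v\<in>?V. f v) = k" by (rule k)
  next
    fix v assume v: "v \<in> ?V"
    have split: "(\<Sum>w\<in>?V. m v w) = m v v + (\<Sum>w\<in>?V - {v}. m v w)"
      using v by (simp add: sum.remove)
    show "(\<Sum>w\<in>?V. m v w) = f v"
    proof (cases "\<sigma> v = v")
      case True
      have "(\<Sum>w\<in>?V - {v}. m v w) = (\<Sum>w\<in>L v. m v w)"
        using True by (intro sum.mono_neutral_right) (auto simp: L_def m_def)
      also have "\<dots> = D v"
        unfolding D_def using True by (intro sum.cong) (auto simp: L_def m_def)
      finally show ?thesis
        using split True D_le[OF v] by (simp add: m_def)
    next
      case False
      \<comment> \<open>A leaf is not the centre of any vertex, so it can only send pebbles to its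
        own centre.\<close>
      have "(\<Sum>w\<in>?V - {v}. m v w) = (\<Sum>w\<in>{\<sigma> v}. m v w)"
        using False \<sigma>(1,2)[OF v] \<sigma>(2) by (intro sum.mono_neutral_right) (auto simp: m_def)
      then show ?thesis
        using split False by (simp add: m_def min_def)
    qed
  next
    fix w assume w: "w \<in> ?V"
    have split: "(\<Sum>v\<in>?V. m v w) = m w w + (\<Sum>v\<in>?V - {w}. m v w)"
      using w by (simp add: sum.remove)
    show "(\<Sum>v\<in>?V. m v w) = g w"
    proof (cases "\<sigma> w = w")
      case True
      have star: "{v\<in>?V. \<sigma> v = w} = insert w (L w)" "w \<notin> L w"
        using True w by (auto simp: L_def)
      have "(\<Sum>v\<in>?V - {w}. m v w) = (\<Sum>v\<in>L w. m v w)"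
        using True by (intro sum.mono_neutral_right) (auto simp: L_def m_def)
      also have "\<dots> = (\<Sum>v\<in>L w. f v - g v)"
        using True by (intro sum.cong) (auto simp: L_def m_def)
      finally have "(\<Sum>v\<in>?V. m v w) = f w - D w + (\<Sum>v\<in>L w. f v - g v)"
        using split True by (simp add: m_def)
      \<comment> \<open>Leaf by leaf, both sides are the maximum of \<open>f v\<close> and
        \<open>g v\<close>, despite the truncated subtractions.\<close>
      moreover have "(\<Sum>v\<in>L w. f v - g v) + (\<Sum>v\<in>L w. g v) = D w + (\<Sum>v\<in>L w. f v)"
        unfolding D_def sum.distrib[symmetric] by (intro sum.cong) auto
      moreover have "f w + (\<Sum>v\<in>L w. f v) = g w + (\<Sum>v\<in>L w. g v)"
        using total[OF w] star finL by simp
      ultimately show ?thesis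
        using D_le[OF w] by linarith
    next
      case False
      have "(\<Sum>v\<in>?V - {w}. m v w) = (\<Sum>v\<in>{\<sigma> w}. m v w)"
        using False \<sigma>(1,2)[OF w] \<sigma>(2) by (intro sum.mono_neutral_right) (auto simp: m_def)
      then show ?thesis
        using split False \<sigma>(2)[OF w] by (simp add: m_def min_def)
    qed
  next
    fix v w assume vw: "v \<in> ?V" "w \<in> ?V" and "m v w \<noteq> 0"
    then have "v = w \<or> \<sigma> v = w \<or> \<sigma> w = v"
      by (auto simp: m_def split: if_splits)
    then show "v = w \<or> (v, w) \<in> parcs G"
      using \<sigma>(3)[OF vw(1)] \<sigma>(3)[OF vw(2)] sym by metis
  qed
qed

section \<open>Orders of magnitude\<close>

text \<open>Positive numbers are grouped into geometric intervals of ratio 1 + 1/n; the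
  \<open>Suc\<close> reserves level 0 for the value 0.\<close>

definition level :: "nat \<Rightarrow> nat \<Rightarrow> nat" where
  "level n m = (if m = 0 then 0 else Suc (nat \<lfloor>log (1 + 1 / real n) (real m)\<rfloor>))"

text \<open>Two positive numbers in one interval differ by a factor below 1 + 1/n. With n the number
  of vertices this is the closeness needed in \<open>pebble_move_along_stars\<close>.\<close>

lemma level_eq_imp_close:
  assumes n: "n > 0" and eq: "level n m = level n m'"
  shows "n * (m' - m) \<le> m"
proof (cases "m < m'")
  case True
  then have pos: "m > 0" "m' > 0"
    using eq by (auto simp: level_def split: if_splits)
  define b where "b = 1 + 1 / real n"
  have b: "b > 1"
    using n by (simp add: b_def)
  \<comment> \<open>Nonnegative logarithms ensure that \<open>nat\<close> does not identify
    different floors.\<close>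
  have "log b m \<ge> 0" "log b m' \<ge> 0"
    using pos b by simp_all
  then have "\<lfloor>log b m\<rfloor> = \<lfloor>log b m'\<rfloor>"
    using eq pos by (simp add: level_def eq_nat_nat_iff b_def)
  then have "log b m' < log b m + 1"
    by linarith
  also have "\<dots> = log b (m * b)"
    using b pos by (simp add: log_mult)
  finally have "real m' < m * b"
    using b pos by simp
  then have "real n * (real m' - real m) < real m"
    using n by (simp add: b_def field_simps)
  then have "real (n * (m' - m)) < real m"
    using True by simp
  then show ?thesis
    by linarith
qed auto

lemma level_le:
  assumes "n > 0" "m \<le> k" "k > 0"
  shows "real (level n m) \<le> 1 + log (1 + 1 / real n) (real k)"
proof -
  let ?b = "1 + 1 / real n"
  have b: "?b > 1"
    using assms by simp
  show ?thesis
  proof (cases "m = 0")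
    case True
    then show ?thesis
      using b assms by (simp add: level_def add_nonneg_nonneg)
  next
    case False
    then have "log ?b m \<le> log ?b k" "log ?b m \<ge> 0"
      using b assms by simp_all
    then show ?thesis
      using False by (simp add: level_def) linarith
  qed
qed

section \<open>The upper bound\<close>

text \<open>Distinct members of an independent set have distinct keys, a key recording levels, star
  partition and star totals. The three factors bound the numbers of choices for these data.\<close>

lemma independence_number_pebble_graph_le:
  fixes G :: "'a pair_pre_digraph" and k :: nat
  assumes "pair_graph G" and ne: "pverts G \<noteq> {}" and "k > 0"
  defines "n \<equiv> card (pverts G)"
  shows "real (independence_number (pebble_graph G k))
    \<le> (2 + log (1 + 1 / real n) (real k)) ^ n * real n ^ n
       * (real k + 1) ^ (independence_number G - 1)"
proof -
  interpret pair_graph G by fact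
  have fin: "finite (pverts G)" "finite (pverts (pebble_graph G k))"
    by (simp_all add: pebble_graph_def finite_configurations)
  let ?V = "pverts G" and ?a = "independence_number G"
  have n: "n > 0"
    using ne by (simp add: n_def card_gt_0_iff)
  define M where "M = nat \<lfloor>1 + log (1 + 1 / real n) (real k)\<rfloor>"
  define sg where "sg f = (SOME \<sigma>. star_partition G f \<sigma>)" for f
  have sg: "star_partition G f (sg f)" for f
    unfolding sg_def by (rule someI_ex[OF ex_star_partition[OF assms(1)]])
  define tot where "tot f = (\<lambda>s. \<Sum>v\<in>{v\<in>?V. sg f v = s}. f v)" for f :: "'a \<Rightarrow> nat"
  define key where "key f = (restrict (level n \<circ> f) ?V, (sg f, tot f))" for f
  define Sg where "Sg = {\<sigma> \<in> ?V \<rightarrow>\<^sub>E ?V. independent_set G (\<sigma> ` ?V)}"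
  \<comment> \<open>The totals live on the centres of the chosen partition, which form an
    independent set of \<open>G\<close>; hence the exponent depends on the independence number and
    not on \<open>n\<close>.\<close>
  let ?K = "(?V \<rightarrow>\<^sub>E {..M}) \<times> (SIGMA \<sigma>:Sg. configurations (\<sigma> ` ?V) k)"
  obtain I where I: "independent_set (pebble_graph G k) I"
      "card I = independence_number (pebble_graph G k)"
    using independence_number_attained[OF fin(2)] .
  have Iconf: "f \<in> configurations ?V k" if "f \<in> I" for f
    using I(1) that by (auto simp: independent_set_def pebble_graph_def)
  have "inj_on key I"
  proof (rule inj_onI, rule ccontr)
    fix f g assume fg: "f \<in> I" "g \<in> I" and e: "key f = key g" and "f \<noteq> g"
    have "pebble_move G k f g"
    proof (rule pebble_move_along_stars[OF assms(1) sg])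
      show "(\<Sum>v\<in>?V. f v) = k"
        using Iconf[OF fg(1)] by (simp add: configurations_def)
      show "card ?V * (g v - f v) \<le> f v" if "v \<in> ?V" for v
      proof -
        have "restrict (level n \<circ> f) ?V v = restrict (level n \<circ> g) ?V v"
          using e by (simp add: key_def)
        then show ?thesis
          using level_eq_imp_close[OF n] that by (simp add: n_def)
      qed
      show "(\<Sum>v\<in>{v\<in>?V. sg f v = s}. f v) = (\<Sum>v\<in>{v\<in>?V. sg f v = s}. g v)" for s
      proof -
        have "sg f = sg g" "tot f s = tot g s"
          using e by (simp_all add: key_def)
        then show ?thesis
          by (simp add: tot_def)
      qed
    qed
    then have "(f, g) \<in> parcs (pebble_graph G k)"
      using Iconf fg \<open>f \<noteq> g\<close> by (simp add: pebble_graph_def)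
    then show False
      using I(1) fg \<open>f \<noteq> g\<close> by (auto simp: independent_set_def pairwise_def)
  qed
  moreover have "key ` I \<subseteq> ?K"
  proof
    fix x assume "x \<in> key ` I"
    then obtain f where f: "f \<in> I" and x: "x = key f"
      by auto
    note fc = Iconf[OF f]
    have "level n (f v) \<le> M" if "v \<in> ?V" for v
    proof -
      have "f v \<le> k"
        using member_le_sum[of v ?V f] fc that by (auto simp: configurations_def)
      then have "real (level n (f v)) \<le> 1 + log (1 + 1 / real n) (real k)"
        using level_le n \<open>k > 0\<close> by blast
      then show ?thesis
        unfolding M_def by linarith
    qed
    moreover have "sg f \<in> Sg"
      using sg[of f] by (simp add: Sg_def star_partition_def)
    moreover have "tot f \<in> configurations (sg f ` ?V) k"
    proof -
      have "tot f s = 0" if "s \<notin> sg f ` ?V" for s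
        unfolding tot_def using that by (intro sum.neutral) auto
      \<comment> \<open>The stars partition the vertices, so each pebble is counted once.\<close>
      moreover have "(\<Sum>s\<in>sg f ` ?V. tot f s) = k"
        unfolding tot_def using fc
        by (subst sum.image_gen[symmetric]) (auto simp: configurations_def)
      ultimately show ?thesis
        by (simp add: configurations_def)
    qed
    ultimately show "x \<in> ?K"
      by (auto simp: x key_def)
  qed
  moreover have finSg: "finite Sg"
    unfolding Sg_def by (rule finite_subset[of _ "?V \<rightarrow>\<^sub>E ?V"]) (auto intro: finite_PiE)
  then have "finite ?K"
    by (intro finite_cartesian_product finite_SigmaI finite_PiE finite_configurations) auto
  ultimately have "card I \<le> card ?K"
    by (rule card_inj_on_le)
  also have "\<dots> = (M + 1) ^ n * (\<Sum>\<sigma>\<in>Sg. card (configurations (\<sigma> ` ?V) k))"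
    using finSg by (simp add: card_cartesian_product card_PiE n_def card_SigmaI finite_configurations)
  also have "(\<Sum>\<sigma>\<in>Sg. card (configurations (\<sigma> ` ?V) k)) \<le> (\<Sum>\<sigma>\<in>Sg. (k + 1) ^ (?a - 1))"
  proof (rule sum_mono)
    fix \<sigma> assume "\<sigma> \<in> Sg"
    then have "card (\<sigma> ` ?V) \<le> ?a"
      by (intro card_le_independence_number) (auto simp: Sg_def)
    then have "(k + 1) ^ (card (\<sigma> ` ?V) - 1) \<le> (k + 1) ^ (?a - 1)"
      by (intro power_increasing) auto
    then show "card (configurations (\<sigma> ` ?V) k) \<le> (k + 1) ^ (?a - 1)"
      using card_configurations_le[of "\<sigma> ` ?V" k] ne by simp
  qed
  also have "\<dots> = card Sg * (k + 1) ^ (?a - 1)"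
    by simp
  also have "card Sg \<le> card (?V \<rightarrow>\<^sub>E ?V)"
    by (intro card_mono) (auto simp: Sg_def intro: finite_PiE)
  also have "\<dots> = n ^ n"
    by (simp add: card_PiE n_def)
  finally have "card I \<le> (M + 1) ^ n * (n ^ n * (k + 1) ^ (?a - 1))"
    by simp
  then have "real (card I) \<le> real ((M + 1) ^ n * (n ^ n * (k + 1) ^ (?a - 1)))"
    by (rule of_nat_mono)
  also have "\<dots> = (real M + 1) ^ n * (real n ^ n * (real k + 1) ^ (?a - 1))"
    by (simp add: add.commute)
  also have "\<dots> \<le> (2 + log (1 + 1 / real n) (real k)) ^ n * (real n ^ n * (real k + 1) ^ (?a - 1))"
  proof (intro mult_right_mono power_mono)
    have "log (1 + 1 / real n) (real k) \<ge> 0"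
      using n \<open>k > 0\<close> by simp
    \<comment> \<open>One unit comes from the bound on levels, the other from counting level 0 in
      \<open>{..M}\<close>.\<close>
    then show "real M + 1 \<le> 2 + log (1 + 1 / real n) (real k)"
      unfolding M_def by linarith
  qed auto
  finally show ?thesis
    using I(2) by (simp add: mult.assoc)
qed

section \<open>The limit\<close>

theorem mainTheorem1:
  fixes G :: "'a pair_pre_digraph"
  assumes "pair_graph G" and "pverts G \<noteq> {}"
  shows "(\<lambda>k. ln (real (independence_number (pebble_graph G k))) / ln (real k))
           \<longlonglongrightarrow> real (independence_number G) - 1"
proof -
  interpret pair_graph G by fact
  define n where "n = card (pverts G)"
  define a where "a = independence_number G"
  define c where "c = ln (1 + 1 / real n)"
  define \<alpha> where "\<alpha> k = independence_number (pebble_graph G k)" for k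
  have n: "n > 0"
    using assms(2) by (simp add: n_def card_gt_0_iff)
  then have c: "c > 0"
    unfolding c_def by (intro ln_gt_zero) simp
  obtain v where "v \<in> pverts G"
    using assms(2) by auto
  then have "card {v} \<le> a"
    unfolding a_def by (intro card_le_independence_number) (auto simp: independent_set_def)
  \<comment> \<open>Positivity of \<open>a\<close> lets the natural number \<open>a - 1\<close> be
    read as \<open>real a - 1\<close>.\<close>
  then have a: "a > 0"
    by simp
  \<comment> \<open>\<open>l\<close> and \<open>u\<close> are the logarithms of the two bounds over
    \<open>ln k\<close>, with \<open>k div a + 1\<close> weakened to k/a in \<open>l\<close>. In
    \<open>u\<close> only the last summand has order \<open>ln k\<close>; the level count
    contributes just O(ln ln k).\<close>
  define l where "l k = (real a - 1) * (ln (real k) - ln (real a)) / ln (real k)" for k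
  define u where "u k = (real n * ln (2 + ln (real k) / c) + real n * ln (real n)
      + (real a - 1) * ln (real k + 1)) / ln (real k)" for k
  have l: "l \<longlonglongrightarrow> real a - 1"
    unfolding l_def by real_asymp
  have u: "u \<longlonglongrightarrow> real a - 1"
    unfolding u_def using c by real_asymp
  have lower: "\<forall>\<^sub>F k in sequentially. l k \<le> ln (real (\<alpha> k)) / ln (real k)"
    using eventually_ge_at_top[of 2]
  proof eventually_elim
    case (elim k)
    have "real k / real a \<le> real (k div a + 1)"
    proof -
      have "k \<le> (k div a + 1) * a"
        using dividend_less_div_times[OF a, of k] by simp
      then have "real k \<le> real (k div a + 1) * real a"
        unfolding of_nat_mult[symmetric] by (rule of_nat_mono)
      then show ?thesis
        using a by (simp only: pos_divide_le_eq of_nat_0_less_iff)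
    qed
    then have "(real k / real a) ^ (a - 1) \<le> real (k div a + 1) ^ (a - 1)"
      by (intro power_mono) auto
    also have "\<dots> \<le> real (\<alpha> k)"
      using independence_number_pebble_graph_ge[OF assms, of k]
      unfolding \<alpha>_def a_def of_nat_power[symmetric] by (rule of_nat_mono)
    finally have "ln ((real k / real a) ^ (a - 1)) \<le> ln (real (\<alpha> k))"
      using a elim by (intro ln_mono) auto
    then have "(real a - 1) * (ln (real k) - ln (real a)) \<le> ln (real (\<alpha> k))"
      using a elim by (simp add: ln_realpow ln_div)
    then show ?case
      using elim by (simp add: l_def divide_right_mono)
  qed
  have upper: "\<forall>\<^sub>F k in sequentially. ln (real (\<alpha> k)) / ln (real k) \<le> u k"
    using eventually_ge_at_top[of 2]
  proof eventually_elim
    case (elim k)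
    have pos: "2 + ln (real k) / c > 0"
      using elim c by (simp add: add_pos_nonneg)
    \<comment> \<open>The lower bound supplies the positivity required for monotonicity of
      \<open>ln\<close>.\<close>
    have "0 < (k div a + 1) ^ (a - 1)"
      by simp
    also have "\<dots> \<le> \<alpha> k"
      using independence_number_pebble_graph_ge[OF assms, of k] by (simp add: \<alpha>_def a_def)
    finally have "\<alpha> k > 0" .
    moreover have "real (\<alpha> k) \<le> (2 + ln (real k) / c) ^ n * real n ^ n * (real k + 1) ^ (a - 1)"
      using independence_number_pebble_graph_le[OF assms, of k] elim
      by (simp add: \<alpha>_def a_def n_def c_def log_def)
    ultimately have "ln (real (\<alpha> k))
        \<le> ln ((2 + ln (real k) / c) ^ n * real n ^ n * (real k + 1) ^ (a - 1))"
      by (intro ln_mono) auto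
    also have "\<dots> = real n * ln (2 + ln (real k) / c) + real n * ln (real n)
        + (real a - 1) * ln (real k + 1)"
      using pos n a by (simp add: ln_mult ln_realpow)
    finally show ?case
      using elim by (simp add: u_def divide_right_mono)
  qed
  from tendsto_sandwich[OF lower upper l u] show ?thesis
    unfolding \<alpha>_def a_def .
qed

end
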